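(* If $n\in\{3,4\}$ and $m\geq3$, then there are infinitely many equivalence classes of homomorphisms $B_n\to B_m$.
   Context: $B_n$ is the braid group on $n$ strands. A homomorphism is called cyclic if its image is a cyclic group. If $\varphi\colon G\to H$ is a homomorphism, $C_H(\varphi(G))$ is the centralizer of $\varphi(G)$ in $H$, and $t\colon G\to C_H(\varphi(G))$ is a cyclic homomorphism, then the transvection of $\varphi$ by $t$ is the homomorphism $\varphi^t\colon G\to H$, $\varphi^t(g)=\varphi(g)t(g)$. Two homomorphisms $G\to H$ are equivalent if they are related by post-composition by an automorphism of $H$ and a (finite) sequence of transvections. *)

theory Defs
  imports "HOL-Algebra.Algebra"
begin

section \<open>Groups given by generators and relations\<close>

text \<open>The letter \<open>(s, True)\<close> stands for the generator \<open>s\<close>, and \<open>(s, False)\<close> for its formal inverse.\<close>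

type_synonym 'a group_word = "('a \<times> bool) list"

definition group_words :: "'a set \<Rightarrow> 'a group_word set" where
  "group_words S = lists (S \<times> UNIV)"

text \<open>A pair \<open>(u, v) \<in> R\<close> is the relation \<open>u = v\<close>. The congruence below identifies two words
  over \<open>S\<close> precisely when they represent the same element of \<open>\<langle>S | R\<rangle>\<close>.\<close>

inductive_set word_cong :: "'a set \<Rightarrow> ('a group_word \<times> 'a group_word) set
    \<Rightarrow> ('a group_word \<times> 'a group_word) set" for S R where
  refl: "w \<in> group_words S \<Longrightarrow> (w, w) \<in> word_cong S R"
| sym: "(u, v) \<in> word_cong S R \<Longrightarrow> (v, u) \<in> word_cong S R"
| trans: "(u, v) \<in> word_cong S R \<Longrightarrow> (v, w) \<in> word_cong S R \<Longrightarrow> (u, w) \<in> word_cong S R"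
| cancel: "s \<in> S \<Longrightarrow> ([(s, b), (s, \<not> b)], []) \<in> word_cong S R"
| rel: "(u, v) \<in> R \<Longrightarrow> u \<in> group_words S \<Longrightarrow> v \<in> group_words S \<Longrightarrow> (u, v) \<in> word_cong S R"
| congr: "(u, v) \<in> word_cong S R \<Longrightarrow> x \<in> group_words S \<Longrightarrow> y \<in> group_words S
    \<Longrightarrow> (x @ u @ y, x @ v @ y) \<in> word_cong S R"

definition presented_group :: "'a set \<Rightarrow> ('a group_word \<times> 'a group_word) set
    \<Rightarrow> 'a group_word set monoid" where
  "presented_group S R =
    \<lparr>carrier = group_words S // word_cong S R,
     monoid.mult = \<lambda>A B. \<Union>a\<in>A. \<Union>b\<in>B. word_cong S R `` {a @ b},
     one = word_cong S R `` {[]}\<rparr>"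

lemma group_words_simps [simp]:
  "[] \<in> group_words S"
  "a # w \<in> group_words S \<longleftrightarrow> fst a \<in> S \<and> w \<in> group_words S"
  "u @ v \<in> group_words S \<longleftrightarrow> u \<in> group_words S \<and> v \<in> group_words S"
  by (cases a; auto simp: group_words_def)+

lemma word_cong_in_words:
  "(u, v) \<in> word_cong S R \<Longrightarrow> u \<in> group_words S \<and> v \<in> group_words S"
  by (induction rule: word_cong.induct) auto

lemma equiv_word_cong: "equiv (group_words S) (word_cong S R)"
proof (rule equivI)
  show "word_cong S R \<subseteq> group_words S \<times> group_words S"
    using word_cong_in_words by fast
  show "refl_on (group_words S) (word_cong S R)"
    using word_cong_in_words by (auto intro!: refl_onI word_cong.refl)
  show "Relation.sym (word_cong S R)" by (auto intro: symI word_cong.sym)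
  show "Relation.trans (word_cong S R)" by (auto intro: transI word_cong.trans)
qed

lemma word_cong_append:
  assumes "(a, a') \<in> word_cong S R" "(b, b') \<in> word_cong S R"
  shows "(a @ b, a' @ b') \<in> word_cong S R"
proof -
  have "(a @ b, a' @ b) \<in> word_cong S R"
    using word_cong.congr[OF assms(1), of "[]" b] word_cong_in_words[OF assms(2)] by simp
  moreover have "(a' @ b, a' @ b') \<in> word_cong S R"
    using word_cong.congr[OF assms(2), of a' "[]"] word_cong_in_words[OF assms(1)] by simp
  ultimately show ?thesis by (rule word_cong.trans)
qed

lemma presented_group_mult:
  assumes "a \<in> group_words S" "b \<in> group_words S"
  shows "word_cong S R `` {a} \<otimes>\<^bsub>presented_group S R\<^esub> word_cong S R `` {b}
    = word_cong S R `` {a @ b}"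
proof -
  have "word_cong S R `` {a' @ b'} = word_cong S R `` {a @ b}"
    if "(a, a') \<in> word_cong S R" "(b, b') \<in> word_cong S R" for a' b'
    using equiv_class_eq[OF equiv_word_cong word_cong_append[OF that]] by simp
  then have "(\<Union>a'\<in>word_cong S R `` {a}. \<Union>b'\<in>word_cong S R `` {b}. word_cong S R `` {a' @ b'})
    = (\<Union>a'\<in>word_cong S R `` {a}. \<Union>b'\<in>word_cong S R `` {b}. word_cong S R `` {a @ b})"
    by (intro SUP_cong HOL.refl) simp
  also have "\<dots> = word_cong S R `` {a @ b}"
  proof -
    have "word_cong S R `` {a} \<noteq> {}" "word_cong S R `` {b} \<noteq> {}"
      using assms word_cong.refl by fast+
    then show ?thesis by simp
  qed
  finally show ?thesis by (simp add: presented_group_def)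
qed

lemma word_cong_left_inverse:
  "w \<in> group_words S \<Longrightarrow> (rev (map (\<lambda>(s, b). (s, \<not> b)) w) @ w, []) \<in> word_cong S R
    \<and> rev (map (\<lambda>(s, b). (s, \<not> b)) w) \<in> group_words S"
proof (induction w)
  case Nil
  then show ?case by (auto intro: word_cong.refl)
next
  case (Cons a w)
  obtain s b where a: "a = (s, b)" by (cases a)
  let ?v = "rev (map (\<lambda>(s, b). (s, \<not> b)) w)"
  have s: "s \<in> S" and w: "w \<in> group_words S" and v: "?v \<in> group_words S"
    and vw: "(?v @ w, []) \<in> word_cong S R"
    using Cons a by auto
  have "([(s, \<not> b), (s, b)], []) \<in> word_cong S R"
    using word_cong.cancel[OF s, of "\<not> b" R] by simp
  from word_cong.congr[OF this v w]
  have "(?v @ [(s, \<not> b), (s, b)] @ w, ?v @ w) \<in> word_cong S R" by simp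
  from word_cong.trans[OF this vw] show ?case using s v by (simp add: a)
qed

lemma group_presented_group: "group (presented_group S R)"
proof (rule groupI)
  let ?G = "presented_group S R"
  have carrier: "x \<in> carrier ?G \<longleftrightarrow> (\<exists>a\<in>group_words S. x = word_cong S R `` {a})" for x
    by (auto simp: presented_group_def quotient_def)
  have one: "\<one>\<^bsub>?G\<^esub> = word_cong S R `` {[]}"
    by (simp add: presented_group_def)
  show "\<one>\<^bsub>?G\<^esub> \<in> carrier ?G"
    unfolding carrier one by (rule bexI[of _ "[]"]) auto
  fix x assume x: "x \<in> carrier ?G"
  then obtain a where a: "a \<in> group_words S" "x = word_cong S R `` {a}"
    unfolding carrier by blast
  show "\<one>\<^bsub>?G\<^esub> \<otimes>\<^bsub>?G\<^esub> x = x"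
    unfolding one a(2) by (simp add: presented_group_mult a(1))
  show "\<exists>y\<in>carrier ?G. y \<otimes>\<^bsub>?G\<^esub> x = \<one>\<^bsub>?G\<^esub>"
  proof
    let ?v = "rev (map (\<lambda>(s, b). (s, \<not> b)) a)"
    note v = word_cong_left_inverse[OF a(1), of R]
    show "word_cong S R `` {?v} \<in> carrier ?G"
      unfolding carrier using v by blast
    show "word_cong S R `` {?v} \<otimes>\<^bsub>?G\<^esub> x = \<one>\<^bsub>?G\<^esub>"
      unfolding one a(2) presented_group_mult[OF conjunct2[OF v] a(1)]
      by (rule equiv_class_eq[OF equiv_word_cong conjunct1[OF v]])
  qed
  fix y assume y: "y \<in> carrier ?G"
  then obtain b where b: "b \<in> group_words S" "y = word_cong S R `` {b}"
    unfolding carrier by blast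
  show "x \<otimes>\<^bsub>?G\<^esub> y \<in> carrier ?G"
    unfolding a(2) b(2) presented_group_mult[OF a(1) b(1)] unfolding carrier
    using a(1) b(1) by (intro bexI[of _ "a @ b"]) auto
  fix z assume z: "z \<in> carrier ?G"
  then obtain c where c: "c \<in> group_words S" "z = word_cong S R `` {c}"
    unfolding carrier by blast
  show "x \<otimes>\<^bsub>?G\<^esub> y \<otimes>\<^bsub>?G\<^esub> z = x \<otimes>\<^bsub>?G\<^esub> (y \<otimes>\<^bsub>?G\<^esub> z)"
    unfolding a(2) b(2) c(2) using a(1) b(1) c(1) by (simp add: presented_group_mult)
qed


section \<open>Braid groups\<close>

text \<open>Artin's presentation, with generators \<open>\<sigma>\<^sub>1, \<dots>, \<sigma>\<^sub>n\<^sub>-\<^sub>1\<close>, where \<open>\<sigma>\<^sub>i\<close> is the half-twist of strands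
  \<open>i\<close> and \<open>i + 1\<close>.\<close>

abbreviation braid_gen :: "nat \<Rightarrow> nat \<times> bool" where
  "braid_gen i \<equiv> (i, True)"

definition braid_relations :: "nat \<Rightarrow> (nat group_word \<times> nat group_word) set" where
  "braid_relations n =
    {([braid_gen i, braid_gen j], [braid_gen j, braid_gen i]) | i j.
        i \<in> {1..<n} \<and> j \<in> {1..<n} \<and> i + 2 \<le> j} \<union>
    {([braid_gen i, braid_gen (i + 1), braid_gen i],
      [braid_gen (i + 1), braid_gen i, braid_gen (i + 1)]) | i.
        i \<in> {1..<n} \<and> i + 1 \<in> {1..<n}}"

definition braid_group :: "nat \<Rightarrow> nat group_word set monoid" where
  "braid_group n = presented_group {1..<n} (braid_relations n)"

lemma group_braid_group: "group (braid_group n)"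
  unfolding braid_group_def by (rule group_presented_group)


section \<open>Equivalence of homomorphisms\<close>

text \<open>Homomorphisms are taken to be extensional, so that there is a single HOL function for each
  mathematical homomorphism; otherwise values off the carrier would be counted too.\<close>

definition homs :: "('a, 'c) monoid_scheme \<Rightarrow> ('b, 'd) monoid_scheme \<Rightarrow> ('a \<Rightarrow> 'b) set" where
  "homs G H = hom G H \<inter> extensional (carrier G)"

definition cyclic_hom :: "('a, 'c) monoid_scheme \<Rightarrow> ('b, 'd) monoid_scheme \<Rightarrow> ('a \<Rightarrow> 'b) \<Rightarrow> bool" where
  "cyclic_hom G H t \<longleftrightarrow> t \<in> hom G H \<and> cyclic_group (H\<lparr>carrier := t ` carrier G\<rparr>)"

definition centralizer :: "('b, 'd) monoid_scheme \<Rightarrow> 'b set \<Rightarrow> 'b set" where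
  "centralizer H A = {h \<in> carrier H. \<forall>a\<in>A. h \<otimes>\<^bsub>H\<^esub> a = a \<otimes>\<^bsub>H\<^esub> h}"

definition transvection ::
  "('a, 'c) monoid_scheme \<Rightarrow> ('b, 'd) monoid_scheme \<Rightarrow> ('a \<Rightarrow> 'b) \<Rightarrow> ('a \<Rightarrow> 'b) \<Rightarrow> 'a \<Rightarrow> 'b" where
  "transvection G H \<phi> t = (\<lambda>g\<in>carrier G. \<phi> g \<otimes>\<^bsub>H\<^esub> t g)"

definition transvection_rel ::
  "('a, 'c) monoid_scheme \<Rightarrow> ('b, 'd) monoid_scheme \<Rightarrow> (('a \<Rightarrow> 'b) \<times> ('a \<Rightarrow> 'b)) set" where
  "transvection_rel G H = {(\<phi>, transvection G H \<phi> t) | \<phi> t.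
     \<phi> \<in> homs G H \<and> cyclic_hom G (H\<lparr>carrier := centralizer H (\<phi> ` carrier G)\<rparr>) t}"

text \<open>Applying the automorphism first loses nothing, because post-composing the transvection of
  \<open>\<phi>\<close> by \<open>t\<close> with \<open>\<alpha>\<close> gives the transvection of \<open>\<alpha> \<circ> \<phi>\<close> by \<open>\<alpha> \<circ> t\<close>; see
  \<open>transvection_rel_compose\<close> and \<open>equiv_hom_equiv\<close> below.\<close>

definition hom_equiv ::
  "('a, 'c) monoid_scheme \<Rightarrow> ('b, 'd) monoid_scheme \<Rightarrow> (('a \<Rightarrow> 'b) \<times> ('a \<Rightarrow> 'b)) set" where
  "hom_equiv G H = {(\<phi>, \<psi>). \<phi> \<in> homs G H \<and> \<psi> \<in> homs G H \<and>
     (\<exists>\<alpha>\<in>auto H. (compose (carrier G) \<alpha> \<phi>, \<psi>) \<in> (transvection_rel G H)\<^sup>*)}"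

lemma cyclic_hom_centralizer:
  assumes "group G" "group H"
    and t: "cyclic_hom G (H\<lparr>carrier := centralizer H A\<rparr>) t"
  shows "t \<in> hom G H" "t ` carrier G \<subseteq> centralizer H A" "subgroup (t ` carrier G) H"
    "cyclic_group (H\<lparr>carrier := t ` carrier G\<rparr>)"
    "\<And>g h. g \<in> carrier G \<Longrightarrow> h \<in> carrier G \<Longrightarrow> t g \<otimes>\<^bsub>H\<^esub> t h = t h \<otimes>\<^bsub>H\<^esub> t g"
proof -
  show th: "t \<in> hom G H"
    using t by (auto simp: cyclic_hom_def hom_def centralizer_def)
  show "t ` carrier G \<subseteq> centralizer H A"
    using t by (auto simp: cyclic_hom_def hom_def)
  show cyc: "cyclic_group (H\<lparr>carrier := t ` carrier G\<rparr>)"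
    using t by (simp add: cyclic_hom_def)
  interpret t: group_hom G H t
    using assms th by (simp add: group_hom_def group_hom_axioms_def)
  show sub: "subgroup (t ` carrier G) H" by (rule t.img_is_subgroup)
  interpret I: group "H\<lparr>carrier := t ` carrier G\<rparr>"
    by (rule subgroup.subgroup_is_group[OF sub assms(2)])
  interpret I: comm_group "H\<lparr>carrier := t ` carrier G\<rparr>"
    by (rule I.cyclic_imp_abelian_group[OF cyc])
  show "\<And>g h. g \<in> carrier G \<Longrightarrow> h \<in> carrier G \<Longrightarrow> t g \<otimes>\<^bsub>H\<^esub> t h = t h \<otimes>\<^bsub>H\<^esub> t g"
    using I.m_comm by simp
qed

lemma transvection_in_homs:
  assumes "group G" "group H" "(\<phi>, \<psi>) \<in> transvection_rel G H"
  shows "\<phi> \<in> homs G H" "\<psi> \<in> homs G H"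
proof -
  interpret G: group G by fact
  interpret H: group H by fact
  obtain t where \<psi>: "\<psi> = transvection G H \<phi> t" and \<phi>: "\<phi> \<in> homs G H"
    and t: "cyclic_hom G (H\<lparr>carrier := centralizer H (\<phi> ` carrier G)\<rparr>) t"
    using assms(3) by (auto simp: transvection_rel_def)
  show "\<phi> \<in> homs G H" by fact
  note T = cyclic_hom_centralizer[OF assms(1,2) t]
  have \<phi>h: "\<phi> \<in> hom G H" using \<phi> by (simp add: homs_def)
  note [simp] = hom_in_carrier[OF T(1)] hom_in_carrier[OF \<phi>h]
  have "\<phi> g \<otimes>\<^bsub>H\<^esub> \<phi> h \<otimes>\<^bsub>H\<^esub> (t g \<otimes>\<^bsub>H\<^esub> t h) = \<phi> g \<otimes>\<^bsub>H\<^esub> t g \<otimes>\<^bsub>H\<^esub> (\<phi> h \<otimes>\<^bsub>H\<^esub> t h)"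
    if gh: "g \<in> carrier G" "h \<in> carrier G" for g h
  proof -
    have "\<phi> h \<otimes>\<^bsub>H\<^esub> t g = t g \<otimes>\<^bsub>H\<^esub> \<phi> h"
      using T(2) gh by (force simp: centralizer_def)
    then have "\<phi> h \<otimes>\<^bsub>H\<^esub> (t g \<otimes>\<^bsub>H\<^esub> t h) = t g \<otimes>\<^bsub>H\<^esub> (\<phi> h \<otimes>\<^bsub>H\<^esub> t h)"
      using gh by (simp flip: H.m_assoc)
    then show ?thesis using gh by (simp add: H.m_assoc)
  qed
  then show "\<psi> \<in> homs G H"
    by (auto simp: \<psi> homs_def transvection_def hom_mult[OF \<phi>h] hom_mult[OF T(1)] intro!: homI)
qed

lemma transvection_rel_sym:
  assumes "group G" "group H" "(\<phi>, \<psi>) \<in> transvection_rel G H"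
  shows "(\<psi>, \<phi>) \<in> transvection_rel G H"
proof -
  interpret G: group G by fact
  interpret H: group H by fact
  obtain t where \<psi>: "\<psi> = transvection G H \<phi> t" and \<phi>: "\<phi> \<in> homs G H"
    and t: "cyclic_hom G (H\<lparr>carrier := centralizer H (\<phi> ` carrier G)\<rparr>) t"
    using assms(3) by (auto simp: transvection_rel_def)
  note T = cyclic_hom_centralizer[OF assms(1,2) t]
  have \<phi>h: "\<phi> \<in> hom G H" and \<phi>e: "\<phi> \<in> extensional (carrier G)" using \<phi> by (simp_all add: homs_def)
  note [simp] = hom_in_carrier[OF T(1)] hom_in_carrier[OF \<phi>h]
  interpret t: group_hom G H t
    using T(1) by unfold_locales
  define u where "u = (\<lambda>g. inv\<^bsub>H\<^esub> t g)"
  have u_inv: "u g = t (inv\<^bsub>G\<^esub> g)" if "g \<in> carrier G" for g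
    using that by (simp add: u_def)
  have u_img: "u ` carrier G = t ` carrier G"
  proof
    show "u ` carrier G \<subseteq> t ` carrier G"
      using u_inv by (auto simp del: t.hom_inv)
    show "t ` carrier G \<subseteq> u ` carrier G"
    proof
      fix x assume "x \<in> t ` carrier G"
      then obtain g where g: "g \<in> carrier G" "x = t g" by blast
      then have "x = u (inv\<^bsub>G\<^esub> g)" by (simp add: u_inv)
      then show "x \<in> u ` carrier G" using g by blast
    qed
  qed
  have u_mult: "u (g \<otimes>\<^bsub>G\<^esub> h) = u g \<otimes>\<^bsub>H\<^esub> u h" if "g \<in> carrier G" "h \<in> carrier G" for g h
    using that T(5)[of "inv\<^bsub>G\<^esub> h" "inv\<^bsub>G\<^esub> g"]
    by (simp add: u_inv G.inv_mult_group del: t.hom_inv)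
  have "t g \<in> centralizer H (\<psi> ` carrier G)" if g: "g \<in> carrier G" for g
  proof -
    have "t g \<otimes>\<^bsub>H\<^esub> (\<phi> h \<otimes>\<^bsub>H\<^esub> t h) = \<phi> h \<otimes>\<^bsub>H\<^esub> t h \<otimes>\<^bsub>H\<^esub> t g" if h: "h \<in> carrier G" for h
    proof -
      have c: "t g \<otimes>\<^bsub>H\<^esub> \<phi> h = \<phi> h \<otimes>\<^bsub>H\<^esub> t g"
        using T(2) g h by (force simp: centralizer_def)
      have "t g \<otimes>\<^bsub>H\<^esub> (\<phi> h \<otimes>\<^bsub>H\<^esub> t h) = \<phi> h \<otimes>\<^bsub>H\<^esub> (t g \<otimes>\<^bsub>H\<^esub> t h)"
        using c g h by (simp flip: H.m_assoc)
      also have "\<dots> = \<phi> h \<otimes>\<^bsub>H\<^esub> t h \<otimes>\<^bsub>H\<^esub> t g"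
        using T(5)[OF g h] g h by (simp add: H.m_assoc)
      finally show ?thesis .
    qed
    then show ?thesis using g by (auto simp: centralizer_def \<psi> transvection_def)
  qed
  then have "u ` carrier G \<subseteq> centralizer H (\<psi> ` carrier G)"
    unfolding u_img by blast
  then have "u g \<in> centralizer H (\<psi> ` carrier G)" if "g \<in> carrier G" for g
    using that by blast
  then have "cyclic_hom G (H\<lparr>carrier := centralizer H (\<psi> ` carrier G)\<rparr>) u"
    using T(4) u_img u_mult by (auto simp: cyclic_hom_def intro!: homI)
  moreover have "\<phi> = transvection G H \<psi> u"
  proof (rule extensionalityI[OF \<phi>e])
    show "transvection G H \<psi> u \<in> extensional (carrier G)" by (simp add: transvection_def)
    show "\<phi> g = transvection G H \<psi> u g" if "g \<in> carrier G" for g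
      using that by (simp add: transvection_def \<psi> u_def H.m_assoc)
  qed
  ultimately show ?thesis
    using transvection_in_homs[OF assms] by (auto simp: transvection_rel_def)
qed

lemma transvection_rel_compose:
  assumes "group G" "group H" "(\<phi>, \<psi>) \<in> transvection_rel G H" and \<alpha>: "\<alpha> \<in> auto H"
  shows "(compose (carrier G) \<alpha> \<phi>, compose (carrier G) \<alpha> \<psi>) \<in> transvection_rel G H"
proof -
  interpret G: group G by fact
  interpret H: group H by fact
  obtain t where \<psi>: "\<psi> = transvection G H \<phi> t" and \<phi>: "\<phi> \<in> homs G H"
    and t: "cyclic_hom G (H\<lparr>carrier := centralizer H (\<phi> ` carrier G)\<rparr>) t"
    using assms(3) by (auto simp: transvection_rel_def)
  note T = cyclic_hom_centralizer[OF assms(1,2) t]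
  have \<phi>h: "\<phi> \<in> hom G H" using \<phi> by (simp_all add: homs_def)
  have \<alpha>h: "\<alpha> \<in> hom H H" using \<alpha> by (simp add: auto_def)
  note [simp] = hom_in_carrier[OF T(1)] hom_in_carrier[OF \<phi>h] hom_in_carrier[OF \<alpha>h]
    hom_mult[OF \<alpha>h] hom_mult[OF \<phi>h] hom_mult[OF T(1)]
  let ?\<phi> = "compose (carrier G) \<alpha> \<phi>" and ?t = "compose (carrier G) \<alpha> t"
  have \<phi>': "?\<phi> \<in> homs G H"
    by (auto simp: homs_def compose_def intro!: homI)
  have img: "?t ` carrier G = \<alpha> ` (t ` carrier G)"
    by (auto simp: compose_def)
  have "\<alpha> x \<in> centralizer H (?\<phi> ` carrier G)" if x: "x \<in> t ` carrier G" for x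
  proof -
    have "x \<in> centralizer H (\<phi> ` carrier G)" using T(2) x by blast
    then have xc: "x \<in> carrier H" "\<And>g. g \<in> carrier G \<Longrightarrow> x \<otimes>\<^bsub>H\<^esub> \<phi> g = \<phi> g \<otimes>\<^bsub>H\<^esub> x"
      by (auto simp: centralizer_def)
    have "\<alpha> x \<otimes>\<^bsub>H\<^esub> \<alpha> (\<phi> g) = \<alpha> (\<phi> g) \<otimes>\<^bsub>H\<^esub> \<alpha> x" if "g \<in> carrier G" for g
      using arg_cong[OF xc(2)[OF that], of \<alpha>] that xc(1) by simp
    then show ?thesis using xc(1) by (auto simp: centralizer_def compose_def)
  qed
  then have "?t ` carrier G \<subseteq> centralizer H (?\<phi> ` carrier G)"
    unfolding img by blast
  moreover have "cyclic_group (H\<lparr>carrier := ?t ` carrier G\<rparr>)"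
  proof -
    have sub: "subgroup (\<alpha> ` (t ` carrier G)) H"
      by (rule group_hom.subgroup_img_is_subgroup[OF _ T(3)])
        (use \<alpha>h in \<open>unfold_locales\<close>)
    have tc: "t ` carrier G \<subseteq> carrier H" by auto
    have "\<alpha> \<in> epi (H\<lparr>carrier := t ` carrier G\<rparr>) (H\<lparr>carrier := \<alpha> ` (t ` carrier G)\<rparr>)"
      using tc by (auto simp: epi_def intro!: homI)
    then show ?thesis
      unfolding img
      using group.cyclic_group_epimorphic_image[OF subgroup.subgroup_is_group[OF T(3) assms(2)] _ T(4)
          subgroup.subgroup_is_group[OF sub assms(2)]]
      by blast
  qed
  moreover have "?t (g \<otimes>\<^bsub>G\<^esub> h) = ?t g \<otimes>\<^bsub>H\<^esub> ?t h" if "g \<in> carrier G" "h \<in> carrier G" for g h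
    using that by (simp add: compose_def)
  ultimately have "cyclic_hom G (H\<lparr>carrier := centralizer H (?\<phi> ` carrier G)\<rparr>) ?t"
    by (auto simp: cyclic_hom_def intro!: homI)
  moreover have "compose (carrier G) \<alpha> \<psi> = transvection G H ?\<phi> ?t"
    by (auto simp: compose_def transvection_def \<psi> fun_eq_iff)
  ultimately show ?thesis
    using \<phi>' by (auto simp: transvection_rel_def)
qed

lemma equiv_hom_equiv:
  fixes G :: "('a, 'c) monoid_scheme" and H :: "('b, 'd) monoid_scheme"
  assumes "group G" "group H"
  shows "equiv (homs G H) (hom_equiv G H)"
proof (rule equivI)
  interpret G: group G by fact
  interpret H: group H by fact
  let ?T = "(transvection_rel G H)\<^sup>*"
  have comp_rtrancl: "(compose (carrier G) \<alpha> \<phi>, compose (carrier G) \<alpha> \<psi>) \<in> ?T"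
    if "(\<phi>, \<psi>) \<in> ?T" "\<alpha> \<in> auto H" for \<phi> \<psi> \<alpha>
    using that(1)
    by (induction rule: rtrancl_induct)
      (auto intro: rtrancl_into_rtrancl transvection_rel_compose[OF assms _ that(2)])
  have sym_T: "(\<psi>, \<phi>) \<in> ?T" if "(\<phi>, \<psi>) \<in> ?T" for \<phi> \<psi>
    using that
    by (induction rule: rtrancl_induct)
      (auto intro: converse_rtrancl_into_rtrancl transvection_rel_sym[OF assms])
  have homs_carrier: "\<phi> g \<in> carrier H" if "\<phi> \<in> homs G H" "g \<in> carrier G" for \<phi> g
    using that hom_in_carrier by (auto simp: homs_def)
  have homs_ext: "\<phi> \<in> extensional (carrier G)" if "\<phi> \<in> homs G H" for \<phi>
    using that by (simp add: homs_def)
  have comp_id: "compose (carrier G) (\<lambda>x\<in>carrier H. x) \<phi> = \<phi>" if "\<phi> \<in> homs G H" for \<phi>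
    by (rule extensionalityI[of _ "carrier G"])
      (use homs_carrier[OF that] homs_ext[OF that] in \<open>auto simp: compose_def\<close>)
  have comp_comp: "compose (carrier G) \<beta> (compose (carrier G) \<alpha> \<phi>)
      = compose (carrier G) (compose (carrier H) \<beta> \<alpha>) \<phi>" if "\<phi> \<in> homs G H" for \<alpha> \<beta> :: "'b \<Rightarrow> 'b" and \<phi>
    using homs_carrier[OF that] by (auto simp: compose_def fun_eq_iff)
  show "hom_equiv G H \<subseteq> homs G H \<times> homs G H"
    by (auto simp: hom_equiv_def)
  show "refl_on (homs G H) (hom_equiv G H)"
  proof (rule refl_onI)
    fix \<phi> assume "\<phi> \<in> homs G H"
    then show "(\<phi>, \<phi>) \<in> hom_equiv G H"
      using comp_id[of \<phi>] by (auto simp: hom_equiv_def intro!: bexI[OF _ H.id_in_auto])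
  qed
  show "Relation.sym (hom_equiv G H)"
  proof (rule symI)
    fix \<phi> \<psi> assume "(\<phi>, \<psi>) \<in> hom_equiv G H"
    then obtain \<alpha> where h: "\<phi> \<in> homs G H" "\<psi> \<in> homs G H" and \<alpha>: "\<alpha> \<in> auto H"
      and T: "(compose (carrier G) \<alpha> \<phi>, \<psi>) \<in> ?T"
      by (auto simp: hom_equiv_def)
    let ?\<beta> = "\<lambda>x\<in>carrier H. inv_into (carrier H) \<alpha> x"
    have \<alpha>B: "\<alpha> \<in> hom H H" "\<alpha> \<in> Bij (carrier H)" using \<alpha> by (auto simp: auto_def)
    have \<beta>: "?\<beta> \<in> auto H"
      using H.restrict_inv_into_hom[OF \<alpha>B] restrict_inv_into_Bij[OF \<alpha>B(2)]
      by (simp add: auto_def)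
    have "(compose (carrier G) ?\<beta> \<psi>, compose (carrier G) ?\<beta> (compose (carrier G) \<alpha> \<phi>)) \<in> ?T"
      by (rule comp_rtrancl[OF sym_T[OF T] \<beta>])
    then have "(compose (carrier G) ?\<beta> \<psi>, \<phi>) \<in> ?T"
      unfolding comp_comp[OF h(1)] Bij_compose_restrict_eq[OF \<alpha>B(2)] comp_id[OF h(1)] .
    then show "(\<psi>, \<phi>) \<in> hom_equiv G H"
      using h \<beta> by (auto simp: hom_equiv_def)
  qed
  show "Relation.trans (hom_equiv G H)"
  proof (rule transI)
    fix \<phi> \<psi> \<chi> assume "(\<phi>, \<psi>) \<in> hom_equiv G H" "(\<psi>, \<chi>) \<in> hom_equiv G H"
    then obtain \<alpha> \<beta> where h: "\<phi> \<in> homs G H" "\<psi> \<in> homs G H" "\<chi> \<in> homs G H"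
      and \<alpha>: "\<alpha> \<in> auto H" "(compose (carrier G) \<alpha> \<phi>, \<psi>) \<in> ?T"
      and \<beta>: "\<beta> \<in> auto H" "(compose (carrier G) \<beta> \<psi>, \<chi>) \<in> ?T"
      by (auto simp: hom_equiv_def)
    have "compose (carrier H) \<beta> \<alpha> \<in> auto H"
      using \<alpha>(1) \<beta>(1) by (auto simp: auto_def compose_Bij intro: H.hom_compose)
    moreover have "(compose (carrier G) (compose (carrier H) \<beta> \<alpha>) \<phi>, \<chi>) \<in> ?T"
      using rtrancl_trans[OF comp_rtrancl[OF \<alpha>(2) \<beta>(1)] \<beta>(2)] unfolding comp_comp[OF h(1)] .
    ultimately show "(\<phi>, \<chi>) \<in> hom_equiv G H"
      using h by (auto simp: hom_equiv_def)
  qed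
qed

end

theory Submission
  imports Defs
begin

text \<open>For \<open>s t s = t s t\<close> and any \<open>c\<close> the elements \<open>p = s\<^sup>c\<^sup>+\<^sup>1 t\<^sup>-\<^sup>c\<close> and \<open>q = t\<^sup>c\<^sup>+\<^sup>1 s\<^sup>-\<^sup>c\<close> satisfy
  \<open>p q p = s t s = q p q\<close>, so \<open>\<sigma>\<^sub>1, \<sigma>\<^sub>3 \<mapsto> p\<close>, \<open>\<sigma>\<^sub>2 \<mapsto> q\<close> defines a homomorphism \<open>\<phi>\<^sub>k\<close> from \<open>B\<^sub>3\<close> or
  \<open>B\<^sub>4\<close> to \<open>B\<^sub>m\<close>, where \<open>s = \<sigma>\<^sub>1\<close>, \<open>t = \<sigma>\<^sub>2\<close> in \<open>B\<^sub>m\<close> and \<open>c = 2 m! k\<close>. Transvections multiply both generators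
  by the same commuting element and therefore fix \<open>p\<^sup>2 q\<^sup>-\<^sup>2\<close>. Under every homomorphism from pure braids
  to the integers this element takes the value \<open>1 + 3 m! k\<close> times that of \<open>s\<^sup>2 t\<^sup>-\<^sup>2\<close>. An automorphism
  of \<open>B\<^sub>m\<close> carrying the element for \<open>j\<close> to that for \<open>k\<close> sends \<open>s\<^sup>2\<close> and \<open>t\<^sup>2\<close> to pure braids, and
  evaluating the linking number of the first two strands gives \<open>1 + 3 m! j dvd 1 + 3 m! k\<close>.
  Equivalence being symmetric, \<open>j = k\<close>.\<close>

section \<open>Presented groups\<close>

definition word_eval :: "('b, 'd) monoid_scheme \<Rightarrow> ('a \<Rightarrow> 'b) \<Rightarrow> 'a group_word \<Rightarrow> 'b" where
  "word_eval K a w = foldr (\<lambda>(s, b) r. (if b then a s else inv\<^bsub>K\<^esub> a s) \<otimes>\<^bsub>K\<^esub> r) w \<one>\<^bsub>K\<^esub>"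

lemma word_eval_simps [simp]:
  "word_eval K a [] = \<one>\<^bsub>K\<^esub>"
  "word_eval K a ((s, b) # w) = (if b then a s else inv\<^bsub>K\<^esub> a s) \<otimes>\<^bsub>K\<^esub> word_eval K a w"
  by (simp_all add: word_eval_def)

context group
begin

lemma word_eval_closed:
  "a \<in> S \<rightarrow> carrier G \<Longrightarrow> w \<in> group_words S \<Longrightarrow> word_eval G a w \<in> carrier G"
  by (induction w) (auto simp: Pi_iff)

lemma word_eval_append:
  assumes "a \<in> S \<rightarrow> carrier G" "u \<in> group_words S" "v \<in> group_words S"
  shows "word_eval G a (u @ v) = word_eval G a u \<otimes> word_eval G a v"
  using assms(2)
proof (induction u)
  case Nil
  then show ?case using word_eval_closed[OF assms(1,3)] by simp
next
  case (Cons x u)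
  then show ?case
    using word_eval_closed[OF assms(1,3)] word_eval_closed[OF assms(1), of u] assms(1)
    by (cases x) (auto simp: m_assoc Pi_iff)
qed

lemma word_eval_cong:
  assumes a: "a \<in> S \<rightarrow> carrier G"
    and rel: "\<And>u v. (u, v) \<in> R \<Longrightarrow> u \<in> group_words S \<Longrightarrow> v \<in> group_words S
      \<Longrightarrow> word_eval G a u = word_eval G a v"
    and "(u, v) \<in> word_cong S R"
  shows "word_eval G a u = word_eval G a v"
  using assms(3)
proof (induction rule: word_cong.induct)
  case (cancel s b)
  then show ?case using a by (cases b) (auto simp: Pi_iff)
next
  case (congr u v x y)
  then show ?case
    using word_cong_in_words[OF congr.hyps(1)] by (simp add: word_eval_append[OF a])
qed (simp_all add: rel)

text \<open>Von Dyck's theorem: evaluation respects every rule that builds the congruence, so it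
  descends to classes. Every map out of a braid group constructed below comes from it.\<close>

lemma presented_group_hom_exists:
  assumes a: "a \<in> S \<rightarrow> carrier G"
    and rel: "\<And>u v. (u, v) \<in> R \<Longrightarrow> u \<in> group_words S \<Longrightarrow> v \<in> group_words S
      \<Longrightarrow> word_eval G a u = word_eval G a v"
  shows "\<exists>F \<in> hom (presented_group S R) G. \<forall>s\<in>S. F (word_cong S R `` {[(s, True)]}) = a s"
proof -
  \<comment> \<open>\<open>SOME\<close> picks an arbitrary representative; by
    \<open>word_eval_cong\<close> the value does not depend on the choice.\<close>
  define F where "F C = word_eval G a (SOME w. w \<in> C)" for C
  have F: "F (word_cong S R `` {w}) = word_eval G a w" if "w \<in> group_words S" for w
  proof -
    have "w \<in> word_cong S R `` {w}" using that word_cong.refl by fast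
    then have "(SOME w'. w' \<in> word_cong S R `` {w}) \<in> word_cong S R `` {w}" by (rule someI)
    then show ?thesis using word_eval_cong[OF a rel] by (force simp: F_def)
  qed
  have "F \<in> hom (presented_group S R) G"
  proof (rule homI)
    fix x y assume "x \<in> carrier (presented_group S R)" "y \<in> carrier (presented_group S R)"
    then obtain u v where uv: "u \<in> group_words S" "x = word_cong S R `` {u}"
      "v \<in> group_words S" "y = word_cong S R `` {v}"
      by (auto simp: presented_group_def quotient_def)
    then show "F x \<in> carrier G" "F (x \<otimes>\<^bsub>presented_group S R\<^esub> y) = F x \<otimes> F y"
      by (simp_all add: F presented_group_mult word_eval_append[OF a] word_eval_closed[OF a])
  qed
  moreover have "\<forall>s\<in>S. F (word_cong S R `` {[(s, True)]}) = a s"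
    using a by (auto simp: F Pi_iff)
  ultimately show ?thesis by blast
qed

end

lemma presented_group_letter_closed:
  "s \<in> S \<Longrightarrow> word_cong S R `` {[(s, b)]} \<in> carrier (presented_group S R)"
  by (auto simp: presented_group_def intro: quotientI)

text \<open>The \<open>cancel\<close> rule makes each \<open>False\<close> letter the inverse of its
  \<open>True\<close> letter, so the latter suffice. This opens properties of all braids to
  induction over \<open>generate\<close>.\<close>

lemma presented_group_generate:
  "carrier (presented_group S R)
    = generate (presented_group S R) ((\<lambda>s. word_cong S R `` {[(s, True)]}) ` S)" (is "_ = generate ?G ?X")
proof
  interpret group ?G by (rule group_presented_group)
  have X: "?X \<subseteq> carrier ?G"
    by (rule image_subsetI) (rule presented_group_letter_closed)
  show "generate ?G ?X \<subseteq> carrier ?G" by (rule generate_incl[OF X])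
  have "word_cong S R `` {w} \<in> generate ?G ?X" if "w \<in> group_words S" for w
    using that
  proof (induction w)
    case Nil
    then show ?case using generate.one[of ?G ?X] by (simp add: presented_group_def)
  next
    case (Cons x w)
    obtain s b where x: "x = (s, b)" by (cases x)
    then have s: "s \<in> S" and w: "w \<in> group_words S" using Cons by auto
    let ?c = "\<lambda>b. word_cong S R `` {[(s, b)]}"
    have T: "?c True \<in> ?X" using s by blast
    have c: "?c b \<in> carrier ?G" for b
      by (rule presented_group_letter_closed[OF s])
    have "?c False \<otimes>\<^bsub>?G\<^esub> ?c True = \<one>\<^bsub>?G\<^esub>"
      using s equiv_class_eq[OF equiv_word_cong word_cong.cancel[of s S False R]]
      by (simp add: presented_group_mult) (simp add: presented_group_def)
    then have "?c False = inv\<^bsub>?G\<^esub> ?c True" by (simp add: c inv_equality)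
    then have "?c b \<in> generate ?G ?X"
      using generate.incl[OF T] generate.inv[OF T, of ?G] by (cases b) auto
    from generate.eng[OF this Cons.IH[OF w]] show ?case
      using s w by (simp add: x presented_group_mult)
  qed
  then show "carrier ?G \<subseteq> generate ?G ?X"
    by (auto simp: presented_group_def quotient_def)
qed

section \<open>Artin generators and their relations\<close>

definition braid_sigma :: "nat \<Rightarrow> nat \<Rightarrow> nat group_word set" where
  "braid_sigma n i = word_cong {1..<n} (braid_relations n) `` {[braid_gen i]}"

lemma braid_sigma_closed [simp]:
  "i \<in> {1..<n} \<Longrightarrow> braid_sigma n i \<in> carrier (braid_group n)"
  unfolding braid_sigma_def braid_group_def by (rule presented_group_letter_closed)

lemma braid_group_generate:
  "carrier (braid_group n) = generate (braid_group n) (braid_sigma n ` {1..<n})"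
  unfolding braid_group_def braid_sigma_def by (rule presented_group_generate)

lemma braid_sigma_commute:
  assumes "i \<in> {1..<n}" "j \<in> {1..<n}" "i + 2 \<le> j"
  shows "braid_sigma n i \<otimes>\<^bsub>braid_group n\<^esub> braid_sigma n j
    = braid_sigma n j \<otimes>\<^bsub>braid_group n\<^esub> braid_sigma n i"
proof -
  have "([braid_gen i, braid_gen j], [braid_gen j, braid_gen i]) \<in> word_cong {1..<n} (braid_relations n)"
    using assms by (intro word_cong.rel) (auto simp: braid_relations_def)
  from equiv_class_eq[OF equiv_word_cong this] show ?thesis
    using assms by (simp add: braid_sigma_def braid_group_def presented_group_mult)
qed

lemma braid_sigma_braid:
  assumes "i \<in> {1..<n}" "i + 1 \<in> {1..<n}"
  shows "braid_sigma n i \<otimes>\<^bsub>braid_group n\<^esub> braid_sigma n (i + 1) \<otimes>\<^bsub>braid_group n\<^esub> braid_sigma n i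
    = braid_sigma n (i + 1) \<otimes>\<^bsub>braid_group n\<^esub> braid_sigma n i \<otimes>\<^bsub>braid_group n\<^esub> braid_sigma n (i + 1)"
proof -
  have "([braid_gen i, braid_gen (i + 1), braid_gen i], [braid_gen (i + 1), braid_gen i, braid_gen (i + 1)])
      \<in> word_cong {1..<n} (braid_relations n)"
    using assms by (intro word_cong.rel) (auto simp: braid_relations_def)
  from equiv_class_eq[OF equiv_word_cong this] show ?thesis
    using assms by (simp add: braid_sigma_def braid_group_def presented_group_mult)
qed

lemma (in group) braid_hom_exists:
  assumes a: "\<And>i. i \<in> {1..<n} \<Longrightarrow> a i \<in> carrier G"
    and comm: "\<And>i j. i \<in> {1..<n} \<Longrightarrow> j \<in> {1..<n} \<Longrightarrow> i + 2 \<le> j \<Longrightarrow> a i \<otimes> a j = a j \<otimes> a i"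
    and braid: "\<And>i. i \<in> {1..<n} \<Longrightarrow> i + 1 \<in> {1..<n}
      \<Longrightarrow> a i \<otimes> a (i + 1) \<otimes> a i = a (i + 1) \<otimes> a i \<otimes> a (i + 1)"
  shows "\<exists>F \<in> hom (braid_group n) G. \<forall>i\<in>{1..<n}. F (braid_sigma n i) = a i"
  unfolding braid_group_def braid_sigma_def
proof (rule presented_group_hom_exists)
  show "a \<in> {1..<n} \<rightarrow> carrier G" using a by blast
  fix u v assume uv: "(u, v) \<in> braid_relations n"
  then consider i j where "i \<in> {1..<n}" "j \<in> {1..<n}" "i + 2 \<le> j"
      "u = [braid_gen i, braid_gen j]" "v = [braid_gen j, braid_gen i]"
    | i where "i \<in> {1..<n}" "i + 1 \<in> {1..<n}" "u = [braid_gen i, braid_gen (i + 1), braid_gen i]"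
      "v = [braid_gen (i + 1), braid_gen i, braid_gen (i + 1)]"
    unfolding braid_relations_def by blast
  then show "word_eval G a u = word_eval G a v"
  proof cases
    case (1 i j)
    then show ?thesis using comm[of i j] a[of i] a[of j] by simp
  next
    case (2 i)
    then show ?thesis using braid[of i] a[of i] a[of "i + 1"] by (simp add: m_assoc)
  qed
qed

section \<open>Pairs satisfying the braid relation\<close>

lemma (in group) inv_mult_cancel:
  "x \<in> carrier G \<Longrightarrow> y \<in> carrier G \<Longrightarrow> inv x \<otimes> (x \<otimes> y) = y"
  "x \<in> carrier G \<Longrightarrow> y \<in> carrier G \<Longrightarrow> x \<otimes> (inv x \<otimes> y) = y"
  by (simp_all flip: m_assoc)

text \<open>The \<open>p\<close> of the overview; exchanging \<open>s\<close> and \<open>t\<close>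
  gives \<open>q\<close>.\<close>

definition braid_twist :: "('a, 'b) monoid_scheme \<Rightarrow> nat \<Rightarrow> 'a \<Rightarrow> 'a \<Rightarrow> 'a" where
  "braid_twist G c s t = s [^]\<^bsub>G\<^esub> Suc c \<otimes>\<^bsub>G\<^esub> inv\<^bsub>G\<^esub> (t [^]\<^bsub>G\<^esub> c)"

text \<open>Squares are compared, not \<open>p\<close> and \<open>q\<close> themselves, because the
  squares of the twists in use are pure braids, on which linking numbers are additive.\<close>

definition square_ratio :: "('a, 'b) monoid_scheme \<Rightarrow> 'a \<Rightarrow> 'a \<Rightarrow> 'a" where
  "square_ratio G p q = p \<otimes>\<^bsub>G\<^esub> p \<otimes>\<^bsub>G\<^esub> inv\<^bsub>G\<^esub> (q \<otimes>\<^bsub>G\<^esub> q)"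

lemma (in group_hom) hom_braid_twist:
  "s \<in> carrier G \<Longrightarrow> t \<in> carrier G \<Longrightarrow> h (braid_twist G c s t) = braid_twist H c (h s) (h t)"
  by (simp add: braid_twist_def hom_nat_pow del: nat_pow_Suc)

lemma (in group_hom) hom_square_ratio:
  "p \<in> carrier G \<Longrightarrow> q \<in> carrier G \<Longrightarrow> h (square_ratio G p q) = square_ratio H (h p) (h q)"
  by (simp add: square_ratio_def)

context group
begin

lemma braid_twist_closed [simp]:
  "s \<in> carrier G \<Longrightarrow> t \<in> carrier G \<Longrightarrow> braid_twist G c s t \<in> carrier G"
  by (simp add: braid_twist_def)

lemma square_ratio_closed [simp]:
  "p \<in> carrier G \<Longrightarrow> q \<in> carrier G \<Longrightarrow> square_ratio G p q \<in> carrier G"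
  by (simp add: square_ratio_def)

lemma pow_intertwine:
  assumes "s \<in> carrier G" "t \<in> carrier G" "d \<in> carrier G" "d \<otimes> t = s \<otimes> d"
  shows "d \<otimes> t [^] (c::nat) = s [^] c \<otimes> d"
proof (induction c)
  case (Suc c)
  have "d \<otimes> t [^] Suc c = d \<otimes> t [^] c \<otimes> t" using assms by (simp add: m_assoc)
  also have "\<dots> = s [^] c \<otimes> (d \<otimes> t)" using Suc assms by (simp add: m_assoc)
  also have "\<dots> = s [^] Suc c \<otimes> d" using assms by (simp add: m_assoc)
  finally show ?case .
qed (use assms in simp)

text \<open>The inner powers cancel and leave \<open>s^c (s t s) t^-c\<close>. Conjugation by
  \<open>s t s\<close> takes \<open>t\<close> to \<open>s\<close>, so the outer powers cancel as
  well.\<close>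

lemma braid_twist_product:
  assumes s: "s \<in> carrier G" and t: "t \<in> carrier G" and b: "s \<otimes> t \<otimes> s = t \<otimes> s \<otimes> t"
  shows "braid_twist G c s t \<otimes> braid_twist G c t s \<otimes> braid_twist G c s t = s \<otimes> t \<otimes> s"
proof -
  define S T where "S = s [^] c" and "T = t [^] c"
  have ST: "S \<in> carrier G" "T \<in> carrier G" using s t by (simp_all add: S_def T_def)
  have "s \<otimes> t \<otimes> s \<otimes> t = s \<otimes> (t \<otimes> s \<otimes> t)" using s t by (simp add: m_assoc)
  then have "s \<otimes> t \<otimes> s \<otimes> t = s \<otimes> (s \<otimes> t \<otimes> s)" by (simp only: b)
  then have D: "(s \<otimes> t \<otimes> s) \<otimes> T = S \<otimes> (s \<otimes> t \<otimes> s)"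
    unfolding S_def T_def using s t by (intro pow_intertwine) simp_all
  have "braid_twist G c s t \<otimes> braid_twist G c t s \<otimes> braid_twist G c s t
      = (S \<otimes> s \<otimes> inv T) \<otimes> (T \<otimes> t \<otimes> inv S) \<otimes> (S \<otimes> s \<otimes> inv T)"
    by (simp add: braid_twist_def S_def T_def)
  also have "\<dots> = S \<otimes> (s \<otimes> t \<otimes> s) \<otimes> inv T"
    using s t ST by (simp add: m_assoc inv_mult_cancel)
  also have "\<dots> = s \<otimes> t \<otimes> s"
    unfolding D[symmetric] using s t ST by (simp add: m_assoc)
  finally show ?thesis .
qed

lemma braid_twist_braid:
  assumes "s \<in> carrier G" "t \<in> carrier G" "s \<otimes> t \<otimes> s = t \<otimes> s \<otimes> t"
  shows "braid_twist G c s t \<otimes> braid_twist G c t s \<otimes> braid_twist G c s t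
    = braid_twist G c t s \<otimes> braid_twist G c s t \<otimes> braid_twist G c t s"
  using braid_twist_product[OF assms] braid_twist_product[of t s c] assms by simp

lemma braid_twist_trivial:
  assumes "s \<in> carrier G" "t \<in> carrier G" "s [^] c = \<one>" "t [^] c = \<one>"
  shows "braid_twist G c s t = s"
  using assms by (simp add: braid_twist_def)

end

text \<open>Here \<open>H\<close> plays the pure braids and \<open>f\<close> a homomorphism to the
  integers. With \<open>A = f (s^2)\<close>, \<open>B = f (t^2)\<close> and the conjugates
  \<open>X = s t^2 s^-1\<close>, \<open>Y = t s^2 t^-1\<close>, one finds
  \<open>f (p^2) = (1 + 2e) A - e f X - e B\<close>, and symmetrically for \<open>q\<close> with
  \<open>Y\<close>. Since \<open>f X = f Y\<close>, the difference is
  \<open>(1 + 3e)(A - B)\<close>.\<close>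

lemma (in normal) square_ratio_braid_twist:
  fixes f :: "'a \<Rightarrow> int"
  assumes s: "s \<in> carrier G" and t: "t \<in> carrier G" and b: "s \<otimes> t \<otimes> s = t \<otimes> s \<otimes> t"
    and s2: "s \<otimes> s \<in> H" and t2: "t \<otimes> t \<in> H"
    and f: "\<And>x y. x \<in> H \<Longrightarrow> y \<in> H \<Longrightarrow> f (x \<otimes> y) = f x + f y"
  shows "f (square_ratio G (braid_twist G (2 * e) s t) (braid_twist G (2 * e) t s))
    = (1 + 3 * int e) * (f (s \<otimes> s) - f (t \<otimes> t))"
proof -
  have f1: "f \<one> = 0" using f[of \<one> \<one>] by simp
  have f_inv: "f (inv x) = - f x" if "x \<in> H" for x
    using f[of x "inv x"] that f1 by (simp add: mem_carrier)
  \<comment> \<open>Only even powers are available: \<open>x\<close> itself need not lie in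
    \<open>H\<close>.\<close>
  have even_pow: "x [^] (2 * e) \<in> H \<and> f (x [^] (2 * e)) = int e * f (x \<otimes> x)"
    if "x \<in> carrier G" "x \<otimes> x \<in> H" for x and e :: nat
  proof (induction e)
    case (Suc e)
    have "x [^] (2 * Suc e) = x [^] (2 * e) \<otimes> (x \<otimes> x)" using that by (simp add: m_assoc)
    then show ?case using Suc that f by (simp add: algebra_simps)
  qed (simp add: f1)
  have conj_pow: "x \<otimes> y [^] (c::nat) \<otimes> inv x = (x \<otimes> y \<otimes> inv x) [^] c"
    if "x \<in> carrier G" "y \<in> carrier G" for x y c
  proof (induction c)
    case (Suc c)
    have "x \<otimes> y [^] Suc c \<otimes> inv x = (x \<otimes> y [^] c \<otimes> inv x) \<otimes> (x \<otimes> y \<otimes> inv x)"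
      using that by (simp add: m_assoc inv_mult_cancel)
    then show ?case using Suc by simp
  qed (use that in simp)
  have twist_sq: "f (braid_twist G (2 * e) x y \<otimes> braid_twist G (2 * e) x y)
      = (1 + 2 * int e) * f (x \<otimes> x) - int e * f (x \<otimes> (y \<otimes> y) \<otimes> inv x) - int e * f (y \<otimes> y)
      \<and> braid_twist G (2 * e) x y \<otimes> braid_twist G (2 * e) x y \<in> H"
    if x: "x \<in> carrier G" and y: "y \<in> carrier G" and x2: "x \<otimes> x \<in> H" and y2: "y \<otimes> y \<in> H" for x y
  proof -
    define P Q Z where "P = x [^] (2 * e)" and "Q = y [^] (2 * e)" and "Z = x \<otimes> y \<otimes> inv x"
    have P: "P \<in> H" "f P = int e * f (x \<otimes> x)" and Q: "Q \<in> H" "f Q = int e * f (y \<otimes> y)"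
      using even_pow x y x2 y2 by (simp_all add: P_def Q_def)
    have Z: "Z \<in> carrier G" "Z \<otimes> Z = x \<otimes> (y \<otimes> y) \<otimes> inv x"
      using x y by (simp_all add: Z_def m_assoc inv_mult_cancel)
    have ZH: "Z \<otimes> Z \<in> H" unfolding Z(2) using x y2 by (rule inv_op_closed2)
    have Zp: "x \<otimes> Q \<otimes> inv x = Z [^] (2 * e)"
      using conj_pow[OF x y] by (simp add: Q_def Z_def)
    have PQ: "P \<in> carrier G" "Q \<in> carrier G" using P Q mem_carrier by auto
    have "x \<otimes> P = P \<otimes> x" unfolding P_def using pow_intertwine[of x x x "2 * e"] x by simp
    then have Px: "P \<otimes> (x \<otimes> z) = x \<otimes> (P \<otimes> z)" if "z \<in> carrier G" for z
      using that x PQ by (simp flip: m_assoc)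
    have "braid_twist G (2 * e) x y \<otimes> braid_twist G (2 * e) x y
        = (P \<otimes> x \<otimes> inv Q) \<otimes> (P \<otimes> x \<otimes> inv Q)"
      by (simp add: braid_twist_def P_def Q_def)
    \<comment> \<open>Regrouping the two odd letters \<open>x\<close> into a conjugation and an
      \<open>x^2\<close> leaves only factors from \<open>H\<close>, to which \<open>f\<close>
      applies.\<close>
    also have "\<dots> = P \<otimes> (inv (x \<otimes> Q \<otimes> inv x) \<otimes> (P \<otimes> ((x \<otimes> x) \<otimes> inv Q)))"
      using x y PQ by (simp add: m_assoc inv_mult_group inv_mult_cancel Px)
    finally have eq: "braid_twist G (2 * e) x y \<otimes> braid_twist G (2 * e) x y
        = P \<otimes> (inv (Z [^] (2 * e)) \<otimes> (P \<otimes> ((x \<otimes> x) \<otimes> inv Q)))" by (simp add: Zp)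
    show ?thesis
      unfolding eq using P Q x2 even_pow[OF Z(1) ZH, of e]
      by (simp add: f f_inv Z(2) algebra_simps)
  qed
  \<comment> \<open>\<open>f\<close> need not be invariant under conjugation by \<open>G\<close>,
    but \<open>X\<close> and \<open>Y\<close> are conjugate by \<open>s^2\<close>, which lies in
    \<open>H\<close>. Equation \<open>E\<close> says that \<open>s t\<close> conjugates
    \<open>s^2\<close> to \<open>t^2\<close>.\<close>
  let ?X = "s \<otimes> (t \<otimes> t) \<otimes> inv s" and ?Y = "t \<otimes> (s \<otimes> s) \<otimes> inv t"
  have E: "s \<otimes> t \<otimes> (s \<otimes> s) = (t \<otimes> t) \<otimes> (s \<otimes> t)"
  proof -
    have "s \<otimes> t \<otimes> (s \<otimes> s) = (s \<otimes> t \<otimes> s) \<otimes> s" using s t by (simp add: m_assoc)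
    also have "\<dots> = t \<otimes> s \<otimes> t \<otimes> s" by (simp only: b)
    also have "\<dots> = t \<otimes> (s \<otimes> t \<otimes> s)" using s t by (simp add: m_assoc)
    also have "\<dots> = t \<otimes> (t \<otimes> s \<otimes> t)" by (simp only: b)
    also have "\<dots> = (t \<otimes> t) \<otimes> (s \<otimes> t)" using s t by (simp add: m_assoc)
    finally show ?thesis .
  qed
  have "(s \<otimes> s) \<otimes> ?Y = s \<otimes> (s \<otimes> t \<otimes> (s \<otimes> s)) \<otimes> inv t"
    using s t by (simp add: m_assoc)
  also have "\<dots> = s \<otimes> ((t \<otimes> t) \<otimes> (s \<otimes> t)) \<otimes> inv t" by (simp only: E)
  also have "\<dots> = ?X \<otimes> (s \<otimes> s)" using s t by (simp add: m_assoc inv_mult_cancel)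
  finally have XY: "(s \<otimes> s) \<otimes> ?Y = ?X \<otimes> (s \<otimes> s)" .
  have "?X \<in> H" "?Y \<in> H" using s t s2 t2 inv_op_closed2 by auto
  then have "f ?X = f ?Y" using f[OF s2, of ?Y] f[OF _ s2, of ?X] XY by simp
  then show ?thesis
    unfolding square_ratio_def using twist_sq[OF s t s2 t2] twist_sq[OF t s t2 s2]
    by (simp add: f f_inv algebra_simps)
qed


section \<open>Linking numbers of pure braids\<close>

text \<open>Trivial centre of the symmetric group: \<open>g\<close> preserves every pair
  \<open>{i, i + 1}\<close>. As \<open>m \<ge> 3\<close>, the pairs \<open>{1, 2}\<close> and
  \<open>{2, 3}\<close> both exist and meet in 2, which is therefore fixed; then so is 1, and the
  others follow one by one.\<close>

lemma permutes_adjacent_commute_id: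
  fixes g :: "nat \<Rightarrow> nat"
  assumes g: "g permutes {1..m}" and m: "m \<ge> 3"
    and comm: "\<And>i. i \<in> {1..<m} \<Longrightarrow> g \<circ> transpose i (Suc i) = transpose i (Suc i) \<circ> g"
  shows "g = id"
proof -
  have inj: "g a = g b \<longleftrightarrow> a = b" for a b
    using permutes_inj[OF g] by (rule inj_eq)
  have pair: "g i \<in> {i, Suc i} \<and> g (Suc i) \<in> {i, Suc i}" if "i \<in> {1..<m}" for i
  proof -
    have "g (Suc i) = transpose i (Suc i) (g i)"
      using fun_cong[OF comm[OF that], of i] by simp
    moreover have "g (Suc i) \<noteq> g i" by (simp add: inj)
    ultimately show ?thesis
      by (cases "g i = i"; cases "g i = Suc i") simp_all
  qed
  have pairs: "g 1 \<in> {1, 2}" "g 2 \<in> {1, 2}" "g 2 \<in> {2, 3}"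
    using pair[of 1] pair[of 2] m by (simp_all add: numeral_2_eq_2 numeral_3_eq_3)
  then have "g 2 = 2" by auto
  then have "g 1 \<noteq> 2" using inj[of 1 2] by simp
  then have "g 1 = 1" using pairs(1) by simp
  have "g i = i" if "1 \<le> i" "i \<le> m" for i
    using that
  proof (induction i rule: dec_induct)
    case base
    show ?case by fact
  next
    case (step i)
    then have "g i = i" "i \<in> {1..<m}" by simp_all
    moreover have "g (Suc i) \<noteq> g i" by (simp add: inj)
    ultimately show ?case using pair[of i] by simp
  qed
  moreover have "g i = i" if "i \<notin> {1..m}" for i
    using g that by (rule permutes_not_in)
  ultimately have "g i = i" for i by (cases "i \<in> {1..m}") simp_all
  then show ?thesis by (simp add: fun_eq_iff)
qed

text \<open>A triple \<open>(a, b, k)\<close> records the positions of two distinguished strands and how often the first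
  has crossed the second from the left; on pure braids that count is their linking number.\<close>

definition crossing :: "nat \<Rightarrow> nat \<times> nat \<times> int \<Rightarrow> nat \<times> nat \<times> int" where
  "crossing i = (\<lambda>(a, b, k). (transpose i (Suc i) a, transpose i (Suc i) b,
     k + of_bool (a = i \<and> b = Suc i)))"

lemma bij_crossing: "bij (crossing i)"
proof (rule o_bij)
  \<comment> \<open>A counted pair leaves \<open>crossing i\<close> with its positions exchanged, so
    the inverse tests for the exchanged pair.\<close>
  let ?g = "\<lambda>(a, b, k). (transpose i (Suc i) a, transpose i (Suc i) b,
     k - of_bool (a = Suc i \<and> b = i))"
  show "?g \<circ> crossing i = id" "crossing i \<circ> ?g = id"
    by (auto simp: crossing_def fun_eq_iff transpose_def)
qed

lemma crossing_commute:
  assumes "i + 2 \<le> j"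
  shows "crossing i \<circ> crossing j = crossing j \<circ> crossing i"
proof -
  have "transpose j (Suc j) a = i \<longleftrightarrow> a = i" "transpose j (Suc j) a = Suc i \<longleftrightarrow> a = Suc i"
    "transpose i (Suc i) a = j \<longleftrightarrow> a = j" "transpose i (Suc i) a = Suc j \<longleftrightarrow> a = Suc j"
    "transpose i (Suc i) (transpose j (Suc j) a) = transpose j (Suc j) (transpose i (Suc i) a)" for a
    using assms by (auto simp: transpose_def)
  then show ?thesis by (auto simp: crossing_def fun_eq_iff)
qed

text \<open>Both sides reverse the same three positions and cross each two of them exactly once, so
  they count alike.\<close>

lemma crossing_braid:
  "crossing i \<circ> crossing (Suc i) \<circ> crossing i = crossing (Suc i) \<circ> crossing i \<circ> crossing (Suc i)"
proof -
  let ?p = "transpose i (Suc i)" and ?q = "transpose (Suc i) (Suc (Suc i))"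
  have "?p a = Suc i \<longleftrightarrow> a = i" "?p a = Suc (Suc i) \<longleftrightarrow> a = Suc (Suc i)"
    "?q a = i \<longleftrightarrow> a = i" "?q a = Suc i \<longleftrightarrow> a = Suc (Suc i)"
    "?q (?p a) = i \<longleftrightarrow> a = Suc i" "?q (?p a) = Suc i \<longleftrightarrow> a = Suc (Suc i)"
    "?p (?q a) = Suc i \<longleftrightarrow> a = i" "?p (?q a) = Suc (Suc i) \<longleftrightarrow> a = Suc i"
    "?p (?q (?p a)) = ?q (?p (?q a))" for a
    by (auto simp: transpose_def)
  then show ?thesis by (simp add: crossing_def fun_eq_iff del: transpose_eq_iff)
qed

lemma BijGroup_UNIV:
  "f \<in> carrier (BijGroup UNIV) \<longleftrightarrow> bij f"
  "bij f \<Longrightarrow> bij g \<Longrightarrow> f \<otimes>\<^bsub>BijGroup UNIV\<^esub> g = f \<circ> g"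
  "\<one>\<^bsub>BijGroup UNIV\<^esub> = id"
  by (auto simp: BijGroup_def Bij_def compose_def fun_eq_iff)

text \<open>Pure braids return strands to their positions, so crossing counts add. Squaring
  \<open>\<sigma>\<^sub>1\<close> crosses the first two strands twice, but only once with the first
  on the left, which gives 1; \<open>\<sigma>\<^sub>2\<close> never crosses these two, which gives
  0.\<close>

lemma braid_linking_number:
  assumes m: "m \<ge> 3"
  obtains \<pi> :: "nat group_word set \<Rightarrow> nat \<Rightarrow> nat" and f :: "nat group_word set \<Rightarrow> int" where
    "\<pi> \<in> hom (braid_group m) (sym_group m)"
    "\<And>i. i \<in> {1..<m} \<Longrightarrow> \<pi> (braid_sigma m i) = transpose i (Suc i)"
    "\<And>x y. x \<in> carrier (braid_group m) \<Longrightarrow> y \<in> carrier (braid_group m) \<Longrightarrow> \<pi> x = id \<Longrightarrow> \<pi> y = id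
      \<Longrightarrow> f (x \<otimes>\<^bsub>braid_group m\<^esub> y) = f x + f y"
    "f (braid_sigma m 1 \<otimes>\<^bsub>braid_group m\<^esub> braid_sigma m 1) = 1"
    "f (braid_sigma m 2 \<otimes>\<^bsub>braid_group m\<^esub> braid_sigma m 2) = 0"
proof -
  let ?B = "braid_group m" and ?K = "BijGroup UNIV :: (nat \<times> nat \<times> int \<Rightarrow> nat \<times> nat \<times> int) monoid"
  interpret B: group ?B by (rule group_braid_group)
  have "\<exists>F \<in> hom ?B (sym_group m). \<forall>i\<in>{1..<m}. F (braid_sigma m i) = transpose i (Suc i)"
    
  proof (rule group.braid_hom_exists[OF sym_group_is_group])
    show "transpose i (Suc i) \<in> carrier (sym_group m)" if "i \<in> {1..<m}" for i
      using that by (auto simp: sym_group_carrier intro: permutes_swap_id)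
  qed (auto simp: sym_group_mult fun_eq_iff transpose_def)
  then obtain \<pi> where \<pi>: "\<pi> \<in> hom ?B (sym_group m)"
    and \<pi>_gen: "\<And>i. i \<in> {1..<m} \<Longrightarrow> \<pi> (braid_sigma m i) = transpose i (Suc i)" by blast
  have "\<exists>F \<in> hom ?B ?K. \<forall>i\<in>{1..<m}. F (braid_sigma m i) = crossing i"
  proof (rule group.braid_hom_exists[OF group_BijGroup])
    show "crossing i \<in> carrier ?K" for i
      by (simp add: BijGroup_UNIV bij_crossing)
    show "crossing i \<otimes>\<^bsub>?K\<^esub> crossing j = crossing j \<otimes>\<^bsub>?K\<^esub> crossing i" if "i + 2 \<le> j" for i j
      using crossing_commute[OF that] by (simp add: BijGroup_UNIV bij_crossing)
    show "crossing i \<otimes>\<^bsub>?K\<^esub> crossing (i + 1) \<otimes>\<^bsub>?K\<^esub> crossing i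
        = crossing (i + 1) \<otimes>\<^bsub>?K\<^esub> crossing i \<otimes>\<^bsub>?K\<^esub> crossing (i + 1)" for i
      using crossing_braid[of i] by (simp add: BijGroup_UNIV bij_crossing bij_comp)
  qed
  then obtain L where L: "L \<in> hom ?B ?K"
    and L_gen: "\<And>i. i \<in> {1..<m} \<Longrightarrow> L (braid_sigma m i) = crossing i" by blast
  interpret S: group "sym_group m" by (rule sym_group_is_group)
  interpret K: group ?K by (rule group_BijGroup)
  interpret \<pi>: group_hom ?B "sym_group m" \<pi> using \<pi> by unfold_locales
  interpret L: group_hom ?B ?K L using L by unfold_locales
  have L_bij: "bij (L x)" if "x \<in> carrier ?B" for x
    using L.hom_closed[OF that] by (simp add: BijGroup_UNIV)
  have L_mult: "L (x \<otimes>\<^bsub>?B\<^esub> y) v = L x (L y v)" if "x \<in> carrier ?B" "y \<in> carrier ?B" for x y v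
    using that by (simp add: BijGroup_UNIV L_bij)
  have \<pi>_mult: "\<pi> (x \<otimes>\<^bsub>?B\<^esub> y) a = \<pi> x (\<pi> y a)" if "x \<in> carrier ?B" "y \<in> carrier ?B" for x y a
    using that by (simp add: sym_group_mult)
  have gens: "braid_sigma m ` {1..<m} \<subseteq> carrier ?B" by auto
  \<comment> \<open>\<open>L x\<close> moves both positions by \<open>\<pi> x\<close> and shifts the
    counter by an amount that depends on the positions alone.\<close>
  define P where "P x \<longleftrightarrow> (\<exists>c. \<forall>a b k. L x (a, b, k) = (\<pi> x a, \<pi> x b, k + c a b))" for x
  have P_gen: "P (braid_sigma m i)" if "i \<in> {1..<m}" for i
    unfolding P_def L_gen[OF that] \<pi>_gen[OF that] crossing_def
    by (intro exI[of _ "\<lambda>a b. of_bool (a = i \<and> b = Suc i)"]) simp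
  have P_inv: "P (inv\<^bsub>?B\<^esub> x)" if x: "x \<in> carrier ?B" and "P x" for x
  proof -
    from \<open>P x\<close> obtain c where c: "\<And>a b k. L x (a, b, k) = (\<pi> x a, \<pi> x b, k + c a b)"
      unfolding P_def by blast
    let ?y = "inv\<^bsub>?B\<^esub> x"
    \<comment> \<open>The right-hand triple is exhibited as a preimage under \<open>L x\<close>;
      injectivity then identifies it with the value of \<open>L ?y\<close>.\<close>
    have "L x (\<pi> ?y a, \<pi> ?y b, k - c (\<pi> ?y a) (\<pi> ?y b)) = (a, b, k)" for a b k
      using x \<pi>_mult[of x ?y] by (simp add: c sym_group_one del: \<pi>.hom_inv)
    moreover have "L x (L ?y (a, b, k)) = (a, b, k)" for a b k
      using x L_mult[of x ?y] by (simp add: BijGroup_UNIV del: L.hom_inv)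
    ultimately have "L ?y (a, b, k) = (\<pi> ?y a, \<pi> ?y b, k - c (\<pi> ?y a) (\<pi> ?y b))" for a b k
      using bij_is_inj[OF L_bij[OF x]] by (metis injD)
    then show ?thesis
      unfolding P_def by (intro exI[of _ "\<lambda>a b. - c (\<pi> ?y a) (\<pi> ?y b)"]) simp
  qed
  have P: "P x" if "x \<in> carrier ?B" for x
    using that unfolding braid_group_generate[of m]
  proof (induction rule: generate.induct)
    case one
    show ?case unfolding P_def by (intro exI[of _ "\<lambda>_ _. 0"]) (simp add: BijGroup_UNIV sym_group_one)
  next
    case (eng x y)
    have xy: "x \<in> carrier ?B" "y \<in> carrier ?B"
      using eng B.generate_in_carrier[OF gens] by auto
    from eng.IH obtain c d where "\<And>a b k. L x (a, b, k) = (\<pi> x a, \<pi> x b, k + c a b)"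
      "\<And>a b k. L y (a, b, k) = (\<pi> y a, \<pi> y b, k + d a b)"
      unfolding P_def by blast
    \<comment> \<open>Cocycle rule: \<open>y\<close> acts first, so the shift of \<open>x\<close> is
      read at the positions to which \<open>y\<close> has moved the strands.\<close>
    then show ?case unfolding P_def
      by (intro exI[of _ "\<lambda>a b. d a b + c (\<pi> y a) (\<pi> y b)"]) (simp add: L_mult \<pi>_mult xy del: L.hom_mult \<pi>.hom_mult)
  qed (use P_gen P_inv in auto)
  \<comment> \<open>The counter of strands 1 and 2, started at 0.\<close>
  define f where "f x = snd (snd (L x (1, 2, 0)))" for x
  have f_add: "f (x \<otimes>\<^bsub>?B\<^esub> y) = f x + f y"
    if xy: "x \<in> carrier ?B" "y \<in> carrier ?B" "\<pi> x = id" "\<pi> y = id" for x y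
  proof -
    from P[OF xy(1)] P[OF xy(2)] obtain c d
      where "\<And>a b k. L x (a, b, k) = (a, b, k + c a b)" "\<And>a b k. L y (a, b, k) = (a, b, k + d a b)"
      unfolding P_def xy(3,4) by auto
    then show ?thesis by (simp add: f_def L_mult xy(1,2) del: L.hom_mult)
  qed
  show thesis
  proof (rule that[OF \<pi> \<pi>_gen f_add])
    have "1 \<in> {1..<m}" "2 \<in> {1..<m}" using m by auto
    then show "f (braid_sigma m 1 \<otimes>\<^bsub>?B\<^esub> braid_sigma m 1) = 1" "f (braid_sigma m 2 \<otimes>\<^bsub>?B\<^esub> braid_sigma m 2) = 0"
      by (simp_all only: f_def L_mult braid_sigma_closed L_gen)
        (simp_all add: crossing_def transpose_def)
  qed
qed

section \<open>The invariant\<close>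

lemma (in group) mult_inv_eq_one:
  "x \<in> carrier G \<Longrightarrow> y \<in> carrier G \<Longrightarrow> x \<otimes> inv y = \<one> \<Longrightarrow> x = y"
  using inv_equality[of x "inv y"] by simp

lemma (in group) commute_inv:
  assumes "x \<in> carrier G" "y \<in> carrier G" and comm: "x \<otimes> y = y \<otimes> x"
  shows "x \<otimes> inv y = inv y \<otimes> x"
proof -
  have "x \<otimes> inv y = inv y \<otimes> (y \<otimes> x) \<otimes> inv y"
    using assms(1,2) by (simp add: m_assoc inv_mult_cancel)
  also have "\<dots> = inv y \<otimes> x"
    unfolding comm[symmetric] using assms(1,2) by (simp add: m_assoc)
  finally show ?thesis .
qed

text \<open>The transvecting map takes one value \<open>z\<close> on both generators. As
  \<open>z\<close> commutes with the image of \<open>\<phi>\<close>, both squares gain the factor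
  \<open>z^2\<close>, which cancels in the ratio.\<close>

lemma transvection_square_ratio:
  assumes H: "group H" and n: "n \<ge> 3"
    and rel: "(\<phi>, \<psi>) \<in> transvection_rel (braid_group n) H"
  shows "square_ratio H (\<psi> (braid_sigma n 1)) (\<psi> (braid_sigma n 2))
    = square_ratio H (\<phi> (braid_sigma n 1)) (\<phi> (braid_sigma n 2))"
proof -
  let ?G = "braid_group n"
  interpret G: group ?G by (rule group_braid_group)
  interpret H: group H by fact
  obtain t where \<psi>: "\<psi> = transvection ?G H \<phi> t" and \<phi>: "\<phi> \<in> homs ?G H"
    and t: "cyclic_hom ?G (H\<lparr>carrier := centralizer H (\<phi> ` carrier ?G)\<rparr>) t"
    using rel by (auto simp: transvection_rel_def)
  note T = cyclic_hom_centralizer[OF group_braid_group H t]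
  interpret t: group_hom ?G H t using T(1) by unfold_locales
  have \<phi>h: "\<phi> \<in> hom ?G H" using \<phi> by (simp add: homs_def)
  let ?s = "braid_sigma n 1" and ?t = "braid_sigma n 2"
  have s: "?s \<in> carrier ?G" and st: "?t \<in> carrier ?G" using n by auto
  note c = hom_in_carrier[OF \<phi>h s] hom_in_carrier[OF \<phi>h st] t.hom_closed[OF s] t.hom_closed[OF st]
  \<comment> \<open>In an abelian image the braid relation forces the two values to be
    equal.\<close>
  have "t ?s \<otimes>\<^bsub>H\<^esub> t ?t \<otimes>\<^bsub>H\<^esub> t ?s = t ?t \<otimes>\<^bsub>H\<^esub> t ?s \<otimes>\<^bsub>H\<^esub> t ?t"
    using arg_cong[OF braid_sigma_braid[of 1 n], of t] n s st by (simp add: numeral_2_eq_2)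
  then have "(t ?s \<otimes>\<^bsub>H\<^esub> t ?t) \<otimes>\<^bsub>H\<^esub> t ?s = (t ?s \<otimes>\<^bsub>H\<^esub> t ?t) \<otimes>\<^bsub>H\<^esub> t ?t"
    using T(5)[OF s st] by simp
  then have teq: "t ?t = t ?s" using c by simp
  have comm: "t ?s \<otimes>\<^bsub>H\<^esub> \<phi> g = \<phi> g \<otimes>\<^bsub>H\<^esub> t ?s" if "g \<in> carrier ?G" for g
    using T(2) s that by (force simp: centralizer_def)
  have sq: "(\<phi> g \<otimes>\<^bsub>H\<^esub> t ?s) \<otimes>\<^bsub>H\<^esub> (\<phi> g \<otimes>\<^bsub>H\<^esub> t ?s) = (\<phi> g \<otimes>\<^bsub>H\<^esub> \<phi> g) \<otimes>\<^bsub>H\<^esub> (t ?s \<otimes>\<^bsub>H\<^esub> t ?s)"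
    if g: "g \<in> carrier ?G" for g
  proof -
    note cg = hom_in_carrier[OF \<phi>h g]
    have "t ?s \<otimes>\<^bsub>H\<^esub> (\<phi> g \<otimes>\<^bsub>H\<^esub> t ?s) = \<phi> g \<otimes>\<^bsub>H\<^esub> (t ?s \<otimes>\<^bsub>H\<^esub> t ?s)"
      using comm[OF g] cg c by (simp flip: H.m_assoc)
    then show ?thesis using cg c by (simp add: H.m_assoc)
  qed
  have "\<psi> ?s = \<phi> ?s \<otimes>\<^bsub>H\<^esub> t ?s" "\<psi> ?t = \<phi> ?t \<otimes>\<^bsub>H\<^esub> t ?s"
    using s st by (simp_all add: \<psi> transvection_def teq)
  moreover have "x \<otimes>\<^bsub>H\<^esub> z \<otimes>\<^bsub>H\<^esub> inv\<^bsub>H\<^esub> (y \<otimes>\<^bsub>H\<^esub> z) = x \<otimes>\<^bsub>H\<^esub> inv\<^bsub>H\<^esub> y"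
    if "x \<in> carrier H" "y \<in> carrier H" "z \<in> carrier H" for x y z
    using that by (simp add: H.m_assoc H.inv_mult_group H.inv_mult_cancel)
  ultimately show ?thesis
    unfolding square_ratio_def using c by (simp only: sq[OF s] sq[OF st] H.m_closed)
qed

text \<open>Along the chain of transvections the ratio is constant, so only the initial automorphism
  acts on it.\<close>

lemma hom_equiv_square_ratio:
  assumes H: "group H" and n: "n \<ge> 3" and "(\<phi>, \<psi>) \<in> hom_equiv (braid_group n) H"
  obtains \<alpha> where "\<alpha> \<in> auto H"
    "\<alpha> (square_ratio H (\<phi> (braid_sigma n 1)) (\<phi> (braid_sigma n 2)))
      = square_ratio H (\<psi> (braid_sigma n 1)) (\<psi> (braid_sigma n 2))"
proof -
  let ?G = "braid_group n"
  obtain \<alpha> where \<phi>: "\<phi> \<in> homs ?G H" and \<alpha>: "\<alpha> \<in> auto H"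
    and T: "(compose (carrier ?G) \<alpha> \<phi>, \<psi>) \<in> (transvection_rel ?G H)\<^sup>*"
    using assms(3) by (auto simp: hom_equiv_def)
  interpret \<alpha>: group_hom H H \<alpha>
    using H \<alpha> by (simp add: group_hom_def group_hom_axioms_def auto_def)
  let ?s = "braid_sigma n 1" and ?t = "braid_sigma n 2"
  have s: "?s \<in> carrier ?G" "?t \<in> carrier ?G" using n by auto
  then have "\<phi> ?s \<in> carrier H" "\<phi> ?t \<in> carrier H"
    using \<phi> hom_in_carrier by (auto simp: homs_def)
  moreover have "square_ratio H (\<psi> ?s) (\<psi> ?t)
      = square_ratio H (compose (carrier ?G) \<alpha> \<phi> ?s) (compose (carrier ?G) \<alpha> \<phi> ?t)"
    using T
  proof (induction rule: rtrancl_induct)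
    case (step \<psi> \<chi>)
    show ?case unfolding transvection_square_ratio[OF H n step.hyps(2)] by (rule step.IH)
  qed simp
  ultimately show thesis
    using that[OF \<alpha>] s by (simp add: \<alpha>.hom_square_ratio compose_def)
qed

text \<open>An automorphism matching the two square ratios sends \<open>\<sigma>\<^sub>1\<^sup>2\<close> and \<open>\<sigma>\<^sub>2\<^sup>2\<close> to pure braids:
  their images in the symmetric group coincide, so they commute with every generator, and the
  symmetric group has trivial centre. Hence \<open>square_ratio_braid_twist\<close> applies on both sides.\<close>

lemma auto_square_ratio_dvd:
  fixes m j k :: nat
  defines "B \<equiv> braid_group m" and "s \<equiv> braid_sigma m 1" and "t \<equiv> braid_sigma m 2"
    and "c \<equiv> \<lambda>j. 2 * (fact m * j)"
  assumes m: "m \<ge> 3" and \<alpha>: "\<alpha> \<in> auto B"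
    and eq: "\<alpha> (square_ratio B (braid_twist B (c j) s t) (braid_twist B (c j) t s))
      = square_ratio B (braid_twist B (c k) s t) (braid_twist B (c k) t s)"
  shows "1 + 3 * int (fact m * j) dvd 1 + 3 * int (fact m * k)"
proof -
  interpret B: group B unfolding B_def by (rule group_braid_group)
  let ?S = "sym_group m"
  interpret S: group ?S by (rule sym_group_is_group)
  obtain \<pi> and f :: "nat group_word set \<Rightarrow> int" where \<pi>: "\<pi> \<in> hom B ?S"
    and \<pi>_gen: "\<And>i. i \<in> {1..<m} \<Longrightarrow> \<pi> (braid_sigma m i) = transpose i (Suc i)"
    and f: "\<And>x y. x \<in> carrier B \<Longrightarrow> y \<in> carrier B \<Longrightarrow> \<pi> x = id \<Longrightarrow> \<pi> y = id
      \<Longrightarrow> f (x \<otimes>\<^bsub>B\<^esub> y) = f x + f y"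
    and fs: "f (s \<otimes>\<^bsub>B\<^esub> s) = 1" and ft: "f (t \<otimes>\<^bsub>B\<^esub> t) = 0"
    using braid_linking_number[OF m] unfolding B_def s_def t_def by metis
  interpret \<pi>: group_hom B ?S \<pi> using \<pi> by unfold_locales
  interpret \<alpha>: group_hom B B \<alpha> using \<alpha> by unfold_locales (simp add: auto_def)
  have sigma [simp]: "braid_sigma m i \<in> carrier B" if "i \<in> {1..<m}" for i
    using that by (simp add: B_def)
  have [simp]: "s \<in> carrier B" "t \<in> carrier B" using m by (simp_all add: s_def t_def)
  have braid: "s \<otimes>\<^bsub>B\<^esub> t \<otimes>\<^bsub>B\<^esub> s = t \<otimes>\<^bsub>B\<^esub> s \<otimes>\<^bsub>B\<^esub> t"
    using braid_sigma_braid[of 1 m] m by (simp add: B_def s_def t_def numeral_2_eq_2)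
  \<comment> \<open>The exponent is a multiple of \<open>m!\<close>, the order of the symmetric
    group, so there each twist collapses to its first argument.\<close>
  have S_pow: "x [^]\<^bsub>?S\<^esub> c i = \<one>\<^bsub>?S\<^esub>" if "x \<in> carrier ?S" for x i
  proof -
    have "x [^]\<^bsub>?S\<^esub> (fact m :: nat) = \<one>\<^bsub>?S\<^esub>"
      using S.pow_order_eq_1[OF that] by (simp add: order_def sym_group_card_carrier)
    then have "x [^]\<^bsub>?S\<^esub> (fact m * (2 * i)) = \<one>\<^bsub>?S\<^esub>"
      using that by (simp flip: S.nat_pow_pow)
    then show ?thesis by (simp add: c_def mult.left_commute)
  qed
  define a b where "a = \<pi> (\<alpha> s)" and "b = \<pi> (\<alpha> t)"
  have ab: "a \<in> carrier ?S" "b \<in> carrier ?S" by (simp_all add: a_def b_def)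
  have \<pi>s: "\<pi> s \<otimes>\<^bsub>?S\<^esub> \<pi> s = \<one>\<^bsub>?S\<^esub>" "\<pi> t \<otimes>\<^bsub>?S\<^esub> \<pi> t = \<one>\<^bsub>?S\<^esub>"
    using \<pi>_gen[of 1] \<pi>_gen[of 2] m by (simp_all add: s_def t_def sym_group_mult sym_group_one)
  have "square_ratio ?S a b = \<pi> (\<alpha> (square_ratio B (braid_twist B (c j) s t) (braid_twist B (c j) t s)))"
    by (simp add: \<alpha>.hom_square_ratio \<pi>.hom_square_ratio \<alpha>.hom_braid_twist \<pi>.hom_braid_twist
        S.braid_twist_trivial S_pow a_def b_def)
  also have "\<dots> = square_ratio ?S (\<pi> s) (\<pi> t)"
    unfolding eq by (simp add: \<pi>.hom_square_ratio \<pi>.hom_braid_twist S.braid_twist_trivial S_pow)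
  also have "\<dots> = \<one>\<^bsub>?S\<^esub>"
    using \<pi>s by (simp add: square_ratio_def)
  finally have aabb: "a \<otimes>\<^bsub>?S\<^esub> a = b \<otimes>\<^bsub>?S\<^esub> b"
    using ab by (auto simp: square_ratio_def intro!: S.mult_inv_eq_one[of "a \<otimes>\<^bsub>?S\<^esub> a" "b \<otimes>\<^bsub>?S\<^esub> b"])
  define g where "g = a \<otimes>\<^bsub>?S\<^esub> a"
  have g: "g \<in> carrier ?S" using ab by (simp add: g_def)
  \<comment> \<open>\<open>g\<close> is the square of both \<open>a\<close> and \<open>b\<close>,
    which settles \<open>i = 1\<close> and \<open>i = 2\<close>; for \<open>i \<ge> 3\<close> the
    generator commutes with \<open>s\<close>, so its image commutes with \<open>a\<close>.\<close>
  have g_gen: "g \<otimes>\<^bsub>?S\<^esub> \<pi> (\<alpha> (braid_sigma m i)) = \<pi> (\<alpha> (braid_sigma m i)) \<otimes>\<^bsub>?S\<^esub> g"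
    if i: "i \<in> {1..<m}" for i
  proof -
    have "i = 1 \<or> i = 2 \<or> i \<ge> 3" using i by auto
    then consider "i = 1" | "i = 2" | "i \<ge> 3" by blast
    then show ?thesis
    proof cases
      case 1
      then show ?thesis using ab by (simp add: g_def a_def s_def S.m_assoc)
    next
      case 2
      then show ?thesis using ab unfolding g_def aabb by (simp add: b_def t_def S.m_assoc)
    next
      case 3
      have "s \<otimes>\<^bsub>B\<^esub> braid_sigma m i = braid_sigma m i \<otimes>\<^bsub>B\<^esub> s"
        using 3 i m by (simp add: B_def s_def braid_sigma_commute)
      from arg_cong[OF this, of "\<lambda>x. \<pi> (\<alpha> x)"]
      have ai: "a \<otimes>\<^bsub>?S\<^esub> \<pi> (\<alpha> (braid_sigma m i)) = \<pi> (\<alpha> (braid_sigma m i)) \<otimes>\<^bsub>?S\<^esub> a"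
        using i by (simp add: a_def)
      then show ?thesis using ab i unfolding g_def by (metis S.m_assoc \<alpha>.hom_closed \<pi>.hom_closed sigma)
    qed
  qed
  have g_comm: "g \<otimes>\<^bsub>?S\<^esub> \<pi> (\<alpha> x) = \<pi> (\<alpha> x) \<otimes>\<^bsub>?S\<^esub> g" if "x \<in> carrier B" for x
    using that[unfolded B_def braid_group_generate] unfolding B_def[symmetric]
  proof (induction rule: generate.induct)
    case one
    show ?case using g by simp
  next
    case (incl h)
    then show ?case using g_gen by blast
  next
    case (inv h)
    then have h: "h \<in> carrier B" "g \<otimes>\<^bsub>?S\<^esub> \<pi> (\<alpha> h) = \<pi> (\<alpha> h) \<otimes>\<^bsub>?S\<^esub> g" using g_gen by auto
    have "g \<otimes>\<^bsub>?S\<^esub> inv\<^bsub>?S\<^esub> \<pi> (\<alpha> h) = inv\<^bsub>?S\<^esub> \<pi> (\<alpha> h) \<otimes>\<^bsub>?S\<^esub> g"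
      using h g by (intro S.commute_inv) simp_all
    then show ?case using h(1) by (simp only: \<alpha>.hom_inv \<pi>.hom_inv \<alpha>.hom_closed)
  next
    case (eng x y)
    have "braid_sigma m ` {1..<m} \<subseteq> carrier B" by auto
    then have xy: "x \<in> carrier B" "y \<in> carrier B"
      using eng.hyps B.generate_in_carrier by auto
    then have c: "\<pi> (\<alpha> x) \<in> carrier ?S" "\<pi> (\<alpha> y) \<in> carrier ?S" by simp_all
    have "g \<otimes>\<^bsub>?S\<^esub> (\<pi> (\<alpha> x) \<otimes>\<^bsub>?S\<^esub> \<pi> (\<alpha> y)) = \<pi> (\<alpha> x) \<otimes>\<^bsub>?S\<^esub> (g \<otimes>\<^bsub>?S\<^esub> \<pi> (\<alpha> y))"
      using eng.IH(1) c g by (simp flip: S.m_assoc)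
    then show ?case using eng.IH(2) c g xy by (simp add: S.m_assoc)
  qed
  \<comment> \<open>As \<open>\<alpha>\<close> is onto, commuting with all
    \<open>\<pi> (\<alpha> x)\<close> includes commuting with every adjacent transposition.\<close>
  have "g = id"
  proof (rule permutes_adjacent_commute_id[OF _ m])
    show "g permutes {1..m}" using g by (simp add: sym_group_carrier)
    fix i assume i: "i \<in> {1..<m}"
    have "braid_sigma m i \<in> \<alpha> ` carrier B"
      using \<alpha> sigma[OF i] by (auto simp: auto_def Bij_def bij_betw_def)
    then obtain x where "x \<in> carrier B" "\<alpha> x = braid_sigma m i" by auto
    then show "g \<circ> transpose i (Suc i) = transpose i (Suc i) \<circ> g"
      using g_comm[of x] \<pi>_gen[OF i] by (simp add: sym_group_mult)
  qed
  \<comment> \<open>The pure braids. The squares of \<open>\<alpha> s\<close> and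
    \<open>\<alpha> t\<close> lie here because both map to \<open>g = id\<close>.\<close>
  let ?N = "kernel B ?S \<pi>"
  have N: "?N \<lhd> B" by (rule \<pi>.normal_kernel)
  have mem: "x \<in> ?N \<longleftrightarrow> x \<in> carrier B \<and> \<pi> x = id" for x
    by (simp add: kernel_def sym_group_one)
  have fN: "f (x \<otimes>\<^bsub>B\<^esub> y) = f x + f y" if "x \<in> ?N" "y \<in> ?N" for x y
    using that f by (simp add: mem)
  note twist = normal.square_ratio_braid_twist[OF N _ _ _ _ _ fN]
  have "f (square_ratio B (braid_twist B (c k) s t) (braid_twist B (c k) t s))
      = (1 + 3 * int (fact m * k)) * (f (s \<otimes>\<^bsub>B\<^esub> s) - f (t \<otimes>\<^bsub>B\<^esub> t))"
    unfolding c_def by (rule twist) (simp_all add: mem sym_group_one \<pi>s braid)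
  moreover have "f (square_ratio B (braid_twist B (c j) (\<alpha> s) (\<alpha> t)) (braid_twist B (c j) (\<alpha> t) (\<alpha> s)))
      = (1 + 3 * int (fact m * j)) * (f (\<alpha> s \<otimes>\<^bsub>B\<^esub> \<alpha> s) - f (\<alpha> t \<otimes>\<^bsub>B\<^esub> \<alpha> t))"
    unfolding c_def
  proof (rule twist)
    show "\<alpha> s \<otimes>\<^bsub>B\<^esub> \<alpha> t \<otimes>\<^bsub>B\<^esub> \<alpha> s = \<alpha> t \<otimes>\<^bsub>B\<^esub> \<alpha> s \<otimes>\<^bsub>B\<^esub> \<alpha> t"
      using arg_cong[OF braid, of \<alpha>] by simp
  qed (use \<open>g = id\<close> aabb in \<open>simp_all add: mem flip: a_def b_def g_def\<close>)
  moreover have "square_ratio B (braid_twist B (c k) s t) (braid_twist B (c k) t s)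
      = square_ratio B (braid_twist B (c j) (\<alpha> s) (\<alpha> t)) (braid_twist B (c j) (\<alpha> t) (\<alpha> s))"
    unfolding eq[symmetric] by (simp add: \<alpha>.hom_square_ratio \<alpha>.hom_braid_twist)
  \<comment> \<open>For \<open>s\<close> and \<open>t\<close> the difference of the values of
    \<open>f\<close> is \<open>1 - 0\<close>; for their images it is some unknown integer, the
    cofactor.\<close>
  ultimately have "1 + 3 * int (fact m * k)
      = (1 + 3 * int (fact m * j)) * (f (\<alpha> s \<otimes>\<^bsub>B\<^esub> \<alpha> s) - f (\<alpha> t \<otimes>\<^bsub>B\<^esub> \<alpha> t))"
    by (simp add: fs ft)
  then show ?thesis by (rule dvdI)
qed

section \<open>A family of pairwise inequivalent homomorphisms\<close>

theorem theorem1p3: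
  fixes n m :: nat
  assumes "n \<in> {3, 4}" and "m \<ge> 3"
  shows "infinite (homs (braid_group n) (braid_group m)
           // hom_equiv (braid_group n) (braid_group m))"
proof -
  let ?G = "braid_group n" and ?H = "braid_group m"
  interpret H: group ?H by (rule group_braid_group)
  note eqv = equiv_hom_equiv[OF group_braid_group[of n] group_braid_group[of m]]
  \<comment> \<open>The factor 2 gives the even exponents of \<open>square_ratio_braid_twist\<close>
    with \<open>e = m! k\<close>; the factor \<open>m!\<close> makes the twists invisible in the
    symmetric group.\<close>
  define s t c where "s = braid_sigma m 1" and "t = braid_sigma m 2" and "c k = 2 * (fact m * k)" for k :: nat
  have st: "s \<in> carrier ?H" "t \<in> carrier ?H" using assms by (simp_all add: s_def t_def)
  have braid: "s \<otimes>\<^bsub>?H\<^esub> t \<otimes>\<^bsub>?H\<^esub> s = t \<otimes>\<^bsub>?H\<^esub> s \<otimes>\<^bsub>?H\<^esub> t"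
    using braid_sigma_braid[of 1 m] assms by (simp add: s_def t_def numeral_2_eq_2)
  have "\<exists>\<phi> \<in> homs ?G ?H. \<phi> (braid_sigma n 1) = braid_twist ?H (c k) s t
      \<and> \<phi> (braid_sigma n 2) = braid_twist ?H (c k) t s" for k
  proof -
    let ?p = "braid_twist ?H (c k) s t" and ?q = "braid_twist ?H (c k) t s"
    have "\<exists>F \<in> hom ?G ?H. \<forall>i\<in>{1..<n}. F (braid_sigma n i) = (if even i then ?q else ?p)"
    proof (rule H.braid_hom_exists)
      fix i j assume "i \<in> {1..<n}" "j \<in> {1..<n}" "i + 2 \<le> j"
      \<comment> \<open>Here \<open>n \<le> 4\<close> enters: the only distant pair is (1, 3), and
        both indices, being odd, go to the same element \<open>?p\<close>.\<close>
      then have "i = 1" "j = 3" using assms(1) by auto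
      then show "(if even i then ?q else ?p) \<otimes>\<^bsub>?H\<^esub> (if even j then ?q else ?p)
          = (if even j then ?q else ?p) \<otimes>\<^bsub>?H\<^esub> (if even i then ?q else ?p)" by simp
    qed (use H.braid_twist_braid[OF st braid, of "c k"] st in auto)
    then obtain F where F: "F \<in> hom ?G ?H"
      "\<forall>i\<in>{1..<n}. F (braid_sigma n i) = (if even i then ?q else ?p)" by blast
    interpret G: group ?G by (rule group_braid_group)
    have "restrict F (carrier ?G) \<in> homs ?G ?H"
      using F(1) by (auto simp: homs_def hom_def)
    then show ?thesis
      using F(2) assms(1) by (intro bexI[of _ "restrict F (carrier ?G)"]) auto
  qed
  then obtain \<phi> where \<phi>: "\<And>k. \<phi> k \<in> homs ?G ?H"
    and \<phi>_gen: "\<And>k. \<phi> k (braid_sigma n 1) = braid_twist ?H (c k) s t"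
      "\<And>k. \<phi> k (braid_sigma n 2) = braid_twist ?H (c k) t s"
    by metis
  have n3: "n \<ge> 3" using assms(1) by auto
  have dvd: "1 + 3 * int (fact m * j) dvd 1 + 3 * int (fact m * k)"
    if rel: "(\<phi> j, \<phi> k) \<in> hom_equiv ?G ?H" for j k
  proof -
    obtain \<alpha> where "\<alpha> \<in> auto ?H"
      "\<alpha> (square_ratio ?H (\<phi> j (braid_sigma n 1)) (\<phi> j (braid_sigma n 2)))
        = square_ratio ?H (\<phi> k (braid_sigma n 1)) (\<phi> k (braid_sigma n 2))"
      using hom_equiv_square_ratio[OF group_braid_group n3 rel] by blast
    then show ?thesis
      using auto_square_ratio_dvd[OF assms(2), of \<alpha> j k]
      unfolding \<phi>_gen c_def s_def t_def by blast
  qed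
  have "inj (\<lambda>k. hom_equiv ?G ?H `` {\<phi> k})"
  proof (rule injI)
    fix j k assume "hom_equiv ?G ?H `` {\<phi> j} = hom_equiv ?G ?H `` {\<phi> k}"
    then have "(\<phi> j, \<phi> k) \<in> hom_equiv ?G ?H" "(\<phi> k, \<phi> j) \<in> hom_equiv ?G ?H"
      using eq_equiv_class[OF _ eqv] \<phi> by metis+
    \<comment> \<open>Symmetry of the equivalence gives divisibility both ways between nonnegative
      integers.\<close>
    then have "1 + 3 * int (fact m * j) = 1 + 3 * int (fact m * k)"
      using dvd by (intro zdvd_antisym_nonneg) auto
    then show "j = k" by simp
  qed
  then have "infinite (range (\<lambda>k. hom_equiv ?G ?H `` {\<phi> k}))"
    by (rule range_inj_infinite)
  moreover have "range (\<lambda>k. hom_equiv ?G ?H `` {\<phi> k}) \<subseteq> homs ?G ?H // hom_equiv ?G ?H"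
    using \<phi> by (auto intro: quotientI)
  ultimately show ?thesis by (rule infinite_super[rotated])
qed

end
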